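(* Let $n,h,b\ge1$ be integers, let $\mathcal{Y}$ be a finite set of labels, and let $\mathcal{C}:\mathcal{I}_{n,h,b}\to\mathcal{Y}$ be any classifier. Then for every real $c>0$ and every integer $p\ge2$, no interesting class induced by $\mathcal{C}$ is $2e^{-c^2/2}$-robust to $L^p$-perturbations of size $\left(c+2\frac{n\sqrt{h}}{2^b}\right)^{2/p}$.
   Context: For integers $n,h,b\ge1$, $\mathcal{I}_{n,h,b}$ is the finite set of all real tensors of shape $(n,n,h)$ each of whose entries lies in the set of $2^b$ equally spaced values $\{x/(2^b-1): x=0,1,\dots,2^b-1\}\subset[0,1]$ ("images"). For a tensor $A$ and an integer $p\ge1$, $\|A\|_p$ is the $p$th root of the sum of the $p$th powers of the absolute values of the entries of $A$. A classifier is a function $\mathcal{C}:\mathcal{I}_{n,h,b}\to\mathcal{Y}$ with $\mathcal{Y}$ a finite set; the classes induced by $\mathcal{C}$ are the preimages $\mathcal{C}^{-1}(y)$, $y\in\mathcal{Y}$. A class is interesting if it is nonempty and contains at most half of the elements of $\mathcal{I}_{n,h,b}$. An image $I$ is robust to $L^p$-perturbations of size $d$ if for all $I'\in\mathcal{I}_{n,h,b}$, $\|I-I'\|_p\le d$ implies $\mathcal{C}(I)=\mathcal{C}(I')$. A class $C$ is $r$-robust to $L^p$-perturbations of size $d$ if $C$ is nonempty and the number of images $I\in C$ that are robust to $L^p$-perturbations of size $d$ is at least $r|C|$. *)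

theory Defs
  imports Complex_Main "HOL-Library.FuncSet"
begin

text \<open>
  A real tensor of shape \<open>(n, n, h)\<close> is a function on index triples.  Images are taken to be
  extensional (\<open>undefined\<close> outside the index set), so that HOL equality of images is equality of
  their entries and the set of images is finite.
\<close>

type_synonym tensor = "nat \<times> nat \<times> nat \<Rightarrow> real"

definition tensor_indices :: "nat \<Rightarrow> nat \<Rightarrow> (nat \<times> nat \<times> nat) set" where
  "tensor_indices n h = {..<n} \<times> {..<n} \<times> {..<h}"

definition pixel_values :: "nat \<Rightarrow> real set" where
  "pixel_values b = {real x / (2 ^ b - 1) | x::nat. x < 2 ^ b}"

definition images :: "nat \<Rightarrow> nat \<Rightarrow> nat \<Rightarrow> tensor set" where
  "images n h b = tensor_indices n h \<rightarrow>\<^sub>E pixel_values b"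

definition lp_norm :: "nat \<Rightarrow> nat \<Rightarrow> nat \<Rightarrow> tensor \<Rightarrow> real" where
  "lp_norm n h p A = root p (\<Sum>i\<in>tensor_indices n h. \<bar>A i\<bar> ^ p)"

definition induced_classes ::
    "nat \<Rightarrow> nat \<Rightarrow> nat \<Rightarrow> 'y set \<Rightarrow> (tensor \<Rightarrow> 'y) \<Rightarrow> tensor set set" where
  "induced_classes n h b Y f = {{I \<in> images n h b. f I = y} | y. y \<in> Y}"

definition interesting :: "nat \<Rightarrow> nat \<Rightarrow> nat \<Rightarrow> tensor set \<Rightarrow> bool" where
  "interesting n h b K \<longleftrightarrow> K \<noteq> {} \<and> real (card K) \<le> real (card (images n h b)) / 2"

definition robust_image ::
    "nat \<Rightarrow> nat \<Rightarrow> nat \<Rightarrow> (tensor \<Rightarrow> 'y) \<Rightarrow> nat \<Rightarrow> real \<Rightarrow> tensor \<Rightarrow> bool" where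
  "robust_image n h b f p d I \<longleftrightarrow>
     (\<forall>I'\<in>images n h b. lp_norm n h p (\<lambda>i. I i - I' i) \<le> d \<longrightarrow> f I = f I')"

definition robust_class ::
    "nat \<Rightarrow> nat \<Rightarrow> nat \<Rightarrow> (tensor \<Rightarrow> 'y) \<Rightarrow> real \<Rightarrow> nat \<Rightarrow> real \<Rightarrow> tensor set \<Rightarrow> bool" where
  "robust_class n h b f r p d K \<longleftrightarrow>
     K \<noteq> {} \<and> real (card {I \<in> K. robust_image n h b f p d I}) \<ge> r * real (card K)"

end

theory Submission
  imports Defs "HOL-Probability.Hoeffding"
begin

text \<open>
  If \<open>K\<close> is an interesting class, \<open>R\<close> its robust images and \<open>B\<close> the complement of \<open>K\<close>, then points
  of \<open>R\<close> and \<open>B\<close> have Euclidean distance more than \<open>c + 2 n sqrt h / 2 ^ b\<close>, because differences of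
  entries lie in \<open>[-1, 1]\<close> and \<open>p \<ge> 2\<close>.  By the triangle inequality their distance for the truncated
  cost \<open>\<Sum>i. max 0 (\<bar>x i - y i\<bar> - 2 / 2 ^ b)\<^sup>2\<close> is more than \<open>c\<^sup>2\<close>.  This cost has Maurey's property
  \<open>\<tau>\<close>: if \<open>g x * p y \<le> exp (cost x y)\<close> for all \<open>x, y\<close>, then the uniform means of \<open>g\<close> and \<open>p\<close> have
  product at most 1.  In one dimension this follows by integrating \<open>ln (g i * p j)\<close> against the
  monotone coupling of the normalisations of \<open>g\<close> and \<open>p\<close>, whose cost is controlled by Pinsker's
  inequality; the property then tensorises.  Applied to \<open>g = 1 + (exp (c\<^sup>2) - 1) * indicator R\<close> and
  \<open>p = indicator B\<close> with \<open>\<bar>B\<bar>\<close> at least half of all images, it gives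
  \<open>\<bar>R\<bar> * (exp (c\<^sup>2) - 1) \<le> 2 * \<bar>K\<bar>\<close>, which is stronger than the claim whenever \<open>exp (c\<^sup>2 / 2) \<ge> 2\<close>; for
  smaller \<open>c\<close> the claim is trivial.
\<close>

section \<open>Pinsker's inequality relative to the uniform distribution\<close>

text \<open>This is \<open>ln t \<le> t - 1\<close> at \<open>t = y / x\<close>, kept with its
  linear terms; summed over two distributions it becomes Gibbs' inequality.\<close>

lemma mult_ln_ge:
  fixes x y :: real
  assumes "x \<ge> 0" "y > 0"
  shows "x * ln y + x - y \<le> x * ln x"
proof (cases "x = 0")
  case False
  with assms have x: "x > 0" by simp
  have "x * ln (y / x) \<le> x * (y / x - 1)"
    using x assms by (intro mult_left_mono ln_le_minus_one) auto
  also have "\<dots> = y - x" using x by (simp add: field_simps)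
  finally show ?thesis using x assms by (simp add: ln_div algebra_simps)
qed (use assms in simp)

text \<open>
  The Donsker--Varadhan bound with the exponential tilt \<open>u\<close> of rate \<open>l\<close> on \<open>A\<close>; Hoeffding's lemma
  bounds the normalising constant \<open>Z\<close>, and \<open>l\<close> is the optimal rate.
\<close>

lemma pinsker_uniform_aux:
  fixes R :: "'a \<Rightarrow> real"
  assumes fin: "finite V" and ne: "V \<noteq> {}" and A: "A \<subseteq> V"
    and R: "\<And>i. i \<in> V \<Longrightarrow> R i \<ge> 0" and R1: "sum R V = 1"
    and ge: "sum R A \<ge> card A / card V"
  shows "2 * (sum R A - card A / card V)\<^sup>2 \<le> ln (card V) + (\<Sum>i\<in>V. R i * ln (R i))"
proof -
  define p where "p = real (card A) / card V"
  define l where "l = 4 * (sum R A - p)"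
  define u where "u = (\<lambda>i. if i \<in> A then exp l else (1::real))"
  define Z where "Z = sum u V"
  have V0: "real (card V) > 0" using fin ne by (simp add: card_gt_0_iff)
  have l0: "l \<ge> 0" using ge by (simp add: l_def p_def)
  have VA: "V \<inter> A = A" using A by auto
  have AV: "A \<inter> V = A" using A by auto
  have u_pos: "u i > 0" for i by (simp add: u_def)
  have "Z = (\<Sum>i\<in>V. 1 + (if i \<in> A then exp l - 1 else 0))"
    unfolding Z_def u_def by (intro sum.cong) auto
  also have "\<dots> = card V + card A * (exp l - 1)"
    using fin by (simp add: sum.distrib sum.If_cases VA)
  finally have Z: "Z = card V * (1 + p * (exp l - 1))"
    using V0 by (simp add: p_def distrib_left)
  have p0: "p \<ge> 0" by (simp add: p_def)
  have f0: "1 + p * (exp l - 1) > 0" using l0 p0 by (intro add_pos_nonneg mult_nonneg_nonneg) auto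
  have Z0: "Z > 0" using Z f0 V0 by simp
  have lnZ: "ln Z \<le> ln (card V) + l * p + l\<^sup>2 / 8"
    using Hoeffdings_lemma_aux[OF l0 p0] Z f0 V0 by (simp add: ln_mult)
  have lnu: "ln (u i) = (if i \<in> A then l else 0)" for i by (simp add: u_def)
  have "(\<Sum>i\<in>V. R i * ln (u i)) = (\<Sum>i\<in>V. if i \<in> A then l * R i else 0)"
    by (intro sum.cong) (auto simp: lnu)
  also have "\<dots> = l * sum R A"
    using fin by (simp add: sum.If_cases VA sum_distrib_left)
  finally have Ru: "(\<Sum>i\<in>V. R i * ln (u i)) = l * sum R A" .
  \<comment> \<open>Both \<open>R\<close> and \<open>u / Z\<close> have total mass 1, so the linear
    terms cancel in the sum.\<close>
  have "(\<Sum>i\<in>V. R i * ln (u i / Z) + R i - u i / Z) \<le> (\<Sum>i\<in>V. R i * ln (R i))"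
    using u_pos Z0 R by (intro sum_mono mult_ln_ge) auto
  moreover have "(\<Sum>i\<in>V. R i * ln (u i / Z) + R i - u i / Z)
      = (\<Sum>i\<in>V. R i * ln (u i)) - sum R V * ln Z + sum R V - Z / Z"
    using u_pos Z0 
    by (simp add: ln_div Z_def sum.distrib sum_subtractf sum_distrib_right
        right_diff_distrib less_imp_neq[symmetric] flip: sum_divide_distrib)
  ultimately have "l * sum R A - ln Z \<le> (\<Sum>i\<in>V. R i * ln (R i))"
    using Ru R1 Z0 by simp
  with lnZ have "l * (sum R A - p) - l\<^sup>2 / 8 \<le> ln (card V) + (\<Sum>i\<in>V. R i * ln (R i))"
    by (simp add: algebra_simps)
  moreover have "l * (sum R A - p) - l\<^sup>2 / 8 = 2 * (sum R A - p)\<^sup>2"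
    by (simp add: l_def power2_eq_square field_simps)
  ultimately show ?thesis by (simp add: p_def)
qed

text \<open>The right-hand side is the relative entropy of \<open>R\<close> with respect to the
  uniform distribution. A deficit on \<open>A\<close> is an equal excess on \<open>V - A\<close>,
  which reduces to the one-sided bound.\<close>

lemma pinsker_uniform:
  fixes R :: "'a \<Rightarrow> real"
  assumes fin: "finite V" and ne: "V \<noteq> {}" and A: "A \<subseteq> V"
    and R: "\<And>i. i \<in> V \<Longrightarrow> R i \<ge> 0" and R1: "sum R V = 1"
  shows "2 * (sum R A - card A / card V)\<^sup>2 \<le> ln (card V) + (\<Sum>i\<in>V. R i * ln (R i))"
proof (cases "sum R A \<ge> card A / card V")
  case True
  then show ?thesis using assms by (intro pinsker_uniform_aux)
next
  case False
  have V0: "real (card V) > 0" using fin ne by (simp add: card_gt_0_iff)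
  have cA: "real (card (V - A)) = real (card V) - real (card A)"
    using fin A by (simp add: card_Diff_subset finite_subset of_nat_diff card_mono)
  have sA: "sum R (V - A) = 1 - sum R A"
    using fin A R1 by (simp add: sum_diff finite_subset)
  have eq: "sum R (V - A) - card (V - A) / card V = - (sum R A - card A / card V)"
    using V0 by (simp add: cA sA field_simps)
  have "2 * (sum R (V - A) - card (V - A) / card V)\<^sup>2 \<le> ln (card V) + (\<Sum>i\<in>V. R i * ln (R i))"
    using False eq by (intro pinsker_uniform_aux fin ne R R1) auto
  then show ?thesis unfolding eq by (simp only: power2_minus)
qed

section \<open>Monotone coupling and property tau on a one-dimensional grid\<close>

text \<open>
  If \<open>F\<close> and \<open>G\<close> are distribution functions on \<open>{..<q}\<close>, this is the mass that the monotone coupling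
  gives to \<open>(i, j)\<close>: the length of \<open>{F i..F (Suc i)} \<inter> {G j..G (Suc j)}\<close>.
\<close>

definition overlap :: "(nat \<Rightarrow> real) \<Rightarrow> (nat \<Rightarrow> real) \<Rightarrow> nat \<Rightarrow> nat \<Rightarrow> real" where
  "overlap F G i j = max 0 (min (F (Suc i)) (G (Suc j)) - max (F i) (G j))"

lemma overlap_commute: "overlap F G i j = overlap G F j i"
  by (simp add: overlap_def min.commute max.commute)

text \<open>Each overlap is the increment of \<open>G\<close> clamped to the interval from
  \<open>F i\<close> to \<open>F (Suc i)\<close>, so the sum telescopes. Used in both directions, it
  gives the two marginals of the coupling.\<close>

lemma sum_overlap:
  assumes "mono F" "mono G" "G 0 \<le> F i" "F (Suc i) \<le> G n"
  shows "(\<Sum>j<n. overlap F G i j) = F (Suc i) - F i"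
proof -
  define C where "C = (\<lambda>t. min (F (Suc i)) (max (F i) t))"
  have Fi: "F i \<le> F (Suc i)" using assms(1) by (simp add: monoD)
  have "overlap F G i j = C (G (Suc j)) - C (G j)" for j
    using Fi monoD[OF assms(2), of j "Suc j"]
    unfolding overlap_def C_def by (auto simp: min_def max_def)
  then have "(\<Sum>j<n. overlap F G i j) = C (G n) - C (G 0)"
    using sum_lessThan_telescope[of "\<lambda>j. C (G j)" n] by simp
  also have "\<dots> = F (Suc i) - F i"
    using assms(3,4) Fi by (auto simp: C_def min_def max_def)
  finally show ?thesis .
qed

text \<open>
  On the support of the monotone coupling \<open>\<bar>i - j\<bar> - 1\<close> is at most \<open>q\<close> times the sum of the maximal
  deviations of the two distribution functions from the uniform one.  The \<open>- 1\<close> absorbs the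
  discretisation error.
\<close>

lemma grid_infimum_convolution:
  fixes g p :: "nat \<Rightarrow> real" and q :: nat
  assumes q: "q > 0"
    and g: "\<And>i. i < q \<Longrightarrow> g i \<ge> 0" and p: "\<And>j. j < q \<Longrightarrow> p j \<ge> 0"
    and le: "\<And>i j. i < q \<Longrightarrow> j < q \<Longrightarrow>
               g i * p j \<le> exp ((max 0 ((\<bar>real i - real j\<bar> - 1) / q))\<^sup>2)"
  shows "sum g {..<q} * sum p {..<q} \<le> (real q)\<^sup>2"
proof (cases "sum g {..<q} = 0 \<or> sum p {..<q} = 0")
  case True
  then show ?thesis by auto
next
  case False
  define G where "G = sum g {..<q}"
  define H where "H = sum p {..<q}"
  have "G \<ge> 0" "H \<ge> 0" unfolding G_def H_def using g p by (auto intro!: sum_nonneg)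
  with False have GH: "G > 0" "H > 0" by (auto simp: G_def H_def)
  \<comment> \<open>The extension by zero beyond \<open>q\<close> makes the distribution functions
    monotone on all naturals.\<close>
  define R where "R = (\<lambda>i. if i < q then g i / G else 0)"
  define P where "P = (\<lambda>i. if i < q then p i / H else 0)"
  have R0: "R i \<ge> 0" and P0: "P i \<ge> 0" for i using g p GH by (auto simp: R_def P_def)
  have R1: "sum R {..<q} = 1"
    using GH by (simp add: R_def sum_divide_distrib[symmetric] G_def[symmetric])
  have P1: "sum P {..<q} = 1"
    using GH by (simp add: P_def sum_divide_distrib[symmetric] H_def[symmetric])
  define FR where "FR = (\<lambda>n. sum R {..<n})"
  define FP where "FP = (\<lambda>n. sum P {..<n})"
  have mono: "mono FR" "mono FP"
    unfolding FR_def FP_def using R0 P0 by (auto intro!: monoI sum_mono2)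
  have ends: "FR 0 = 0" "FP 0 = 0" "FR q = 1" "FP q = 1"
    using R1 P1 by (auto simp: FR_def FP_def)
  have bds: "0 \<le> FR i" "0 \<le> FP i" for i
    using monoD[OF mono(1), of 0 i] monoD[OF mono(2), of 0 i] ends by auto
  have bds1: "FR i \<le> 1" "FP i \<le> 1" if "i \<le> q" for i
    using that monoD[OF mono(1), of i q] monoD[OF mono(2), of i q] ends by auto
  define w where "w = overlap FR FP"
  have w0: "w i j \<ge> 0" for i j by (simp add: w_def overlap_def)
  have w1: "(\<Sum>j<q. w i j) = R i" if "i < q" for i
    using sum_overlap[OF mono, of i q] that ends bds bds1(1)[of "Suc i"]
    by (simp add: w_def) (simp add: FR_def)
  have w2: "(\<Sum>i<q. w i j) = P j" if "j < q" for j
    using sum_overlap[OF mono(2,1), of j q] that ends bds bds1(2)[of "Suc j"]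
    by (simp add: w_def overlap_commute[of FR]) (simp add: FP_def)
  \<comment> \<open>These are the relative entropies to uniform; Pinsker on initial segments bounds
    the deviations of \<open>FR\<close> and \<open>FP\<close>.\<close>
  define kR where "kR = ln q + (\<Sum>i<q. R i * ln (R i))"
  define kP where "kP = ln q + (\<Sum>i<q. P i * ln (P i))"
  have devR: "2 * (FR n - n / q)\<^sup>2 \<le> kR" if "n \<le> q" for n
    using pinsker_uniform[of "{..<q}" "{..<n}" R] that q R0 R1 by (auto simp: FR_def kR_def)
  have devP: "2 * (FP n - n / q)\<^sup>2 \<le> kP" if "n \<le> q" for n
    using pinsker_uniform[of "{..<q}" "{..<n}" P] that q P0 P1 by (auto simp: FP_def kP_def)
  have devR': "2 * (n / q - FR n)\<^sup>2 \<le> kR" if "n \<le> q" for n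
    by (subst power2_commute) (rule devR[OF that])
  have devP': "2 * (n / q - FP n)\<^sup>2 \<le> kP" if "n \<le> q" for n
    by (subst power2_commute) (rule devP[OF that])
  have k0: "kR \<ge> 0" "kP \<ge> 0" using devR[of 0] devP[of 0] ends by auto
  \<comment> \<open>Since \<open>(a + b)^2 \<le> 2 * a^2 + 2 * b^2\<close>, the factor 2 in
    Pinsker's inequality is exactly what a cost with constant 1 needs.\<close>
  have sumsq: "(max 0 d)\<^sup>2 \<le> kR + kP"
    if "d \<le> (a + b)" "2 * a\<^sup>2 \<le> kR" "2 * b\<^sup>2 \<le> kP" for a b d :: real
  proof (cases "d \<le> 0")
    case False
    then have "d\<^sup>2 \<le> (a + b)\<^sup>2" using that by (intro power_mono) auto
    also have "\<dots> \<le> 2 * a\<^sup>2 + 2 * b\<^sup>2"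
      using zero_le_power2[of "a - b"] by (simp add: power2_eq_square algebra_simps)
    finally show ?thesis using that False by simp
  qed (use k0 in simp)
  have key: "w i j * (ln (g i) + ln (p j)) \<le> w i j * (kR + kP)" if ij: "i < q" "j < q" for i j
  proof (cases "w i j = 0")
    case False
    with w0[of i j] have wp: "w i j > 0" by simp
    then have ov: "min (FR (Suc i)) (FP (Suc j)) > max (FR i) (FP j)"
      by (simp add: w_def overlap_def max_def split: if_splits)
    then have "R i > 0" "P j > 0" using R0 P0 by (auto simp: FR_def FP_def)
    then have gp: "g i > 0" "p j > 0" using ij GH by (auto simp: R_def P_def zero_less_divide_iff)
    have cost: "(max 0 ((\<bar>real i - real j\<bar> - 1) / q))\<^sup>2 \<le> kR + kP"
    proof (cases i j rule: linorder_cases)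
      case less
      \<comment> \<open>Here \<open>\<bar>i - j\<bar> - 1 = j - Suc i\<close>: the
        \<open>- 1\<close> matches the endpoint \<open>Suc i\<close> of the interval of
        \<open>i\<close> with the endpoint \<open>j\<close> of that of \<open>j\<close>.\<close>
      have "FP j < FR (Suc i)" using ov by auto
      with less q have "(\<bar>real i - real j\<bar> - 1) / q \<le> (FR (Suc i) - Suc i / q) + (j / q - FP j)"
        by (simp add: field_simps)
      from sumsq[OF this devR devP'] show ?thesis using ij by simp
    next
      case greater
      have "FR i < FP (Suc j)" using ov by auto
      with greater q have "(\<bar>real i - real j\<bar> - 1) / q \<le> (i / q - FR i) + (FP (Suc j) - Suc j / q)"
        by (simp add: field_simps)
      from sumsq[OF this devR' devP] show ?thesis using ij by simp
    next
      case equal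
      then show ?thesis using k0 q by (simp add: max_def)
    qed
    have "ln (g i) + ln (p j) = ln (g i * p j)" using gp by (simp add: ln_mult)
    also have "\<dots> \<le> ln (exp ((max 0 ((\<bar>real i - real j\<bar> - 1) / q))\<^sup>2))"
      using gp le[OF ij] by (subst ln_le_cancel_iff) auto
    also have "\<dots> \<le> kR + kP" using cost by simp
    finally show ?thesis using w0[of i j] by (rule mult_left_mono)
  qed simp
  have "(\<Sum>i<q. \<Sum>j<q. w i j * (ln (g i) + ln (p j))) \<le> (\<Sum>i<q. \<Sum>j<q. w i j * (kR + kP))"
    using key by (intro sum_mono) auto
  also have "\<dots> = kR + kP"
    using w1 R1 by (simp add: sum_distrib_right[symmetric])
  finally have main: "(\<Sum>i<q. \<Sum>j<q. w i j * (ln (g i) + ln (p j))) \<le> kR + kP" .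
  \<comment> \<open>By the marginals, the left-hand side is \<open>ln G + ln H\<close> plus the same
    entropy sums as in \<open>kR + kP\<close>; these cancel and leave
    \<open>2 * ln q\<close>.\<close>
  have "(\<Sum>i<q. \<Sum>j<q. w i j * (ln (g i) + ln (p j)))
      = (\<Sum>i<q. \<Sum>j<q. w i j * ln (g i)) + (\<Sum>j<q. \<Sum>i<q. w i j * ln (p j))"
    by (subst (3) sum.swap) (simp add: distrib_left sum.distrib)
  also have "(\<Sum>i<q. \<Sum>j<q. w i j * ln (g i)) = (\<Sum>i<q. R i * ln (g i))"
    using w1 by (simp add: sum_distrib_right[symmetric])
  also have "\<dots> = (\<Sum>i<q. R i * ln (R i) + R i * ln G)"
  proof (intro sum.cong refl)
    fix i assume "i \<in> {..<q}"
    then show "R i * ln (g i) = R i * ln (R i) + R i * ln G"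
      using GH g[of i] by (cases "g i = 0") (auto simp: R_def ln_div algebra_simps)
  qed
  also have "\<dots> = (\<Sum>i<q. R i * ln (R i)) + ln G"
    using R1 by (simp add: sum.distrib sum_distrib_right[symmetric])
  also have "(\<Sum>j<q. \<Sum>i<q. w i j * ln (p j)) = (\<Sum>i<q. P i * ln (p i))"
    using w2 by (simp add: sum_distrib_right[symmetric])
  also have "\<dots> = (\<Sum>i<q. P i * ln (P i) + P i * ln H)"
  proof (intro sum.cong refl)
    fix i assume "i \<in> {..<q}"
    then show "P i * ln (p i) = P i * ln (P i) + P i * ln H"
      using GH p[of i] by (cases "p i = 0") (auto simp: P_def ln_div algebra_simps)
  qed
  also have "\<dots> = (\<Sum>i<q. P i * ln (P i)) + ln H"
    using P1 by (simp add: sum.distrib sum_distrib_right[symmetric])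
  finally have "ln G + ln H \<le> 2 * ln q" using main by (simp add: kR_def kP_def)
  then have "ln (G * H) \<le> ln ((real q)\<^sup>2)" using GH q by (simp add: ln_mult ln_realpow)
  then show ?thesis using GH q by (simp add: G_def[symmetric] H_def[symmetric] del: ln_realpow)
qed

section \<open>Tensorisation\<close>

text \<open>Induction on \<open>J\<close>: for values \<open>s\<close>, \<open>t\<close> of the new
  coordinate, the slice of \<open>g\<close> divided by \<open>k s t\<close> and the slice of
  \<open>p\<close> satisfy the hypothesis on \<open>J\<close>. Hence the slice sums satisfy the
  one-dimensional hypothesis after one division by \<open>M ^ card J\<close>.\<close>

lemma infimum_convolution_PiE:
  fixes k :: "'v \<Rightarrow> 'v \<Rightarrow> real" and g p :: "('j \<Rightarrow> 'v) \<Rightarrow> real"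
  assumes finV: "finite V" and k: "\<And>s t. k s t > 0" and M: "M > 0"
    and base: "\<And>g p :: 'v \<Rightarrow> real. (\<And>s. s \<in> V \<Longrightarrow> g s \<ge> 0) \<Longrightarrow> (\<And>s. s \<in> V \<Longrightarrow> p s \<ge> 0) \<Longrightarrow>
        (\<And>s t. s \<in> V \<Longrightarrow> t \<in> V \<Longrightarrow> g s * p t \<le> k s t) \<Longrightarrow> sum g V * sum p V \<le> M"
    and finJ: "finite J"
    and "\<And>x. x \<in> J \<rightarrow>\<^sub>E V \<Longrightarrow> g x \<ge> 0" and "\<And>x. x \<in> J \<rightarrow>\<^sub>E V \<Longrightarrow> p x \<ge> 0"
    and "\<And>x y. x \<in> J \<rightarrow>\<^sub>E V \<Longrightarrow> y \<in> J \<rightarrow>\<^sub>E V \<Longrightarrow> g x * p y \<le> (\<Prod>i\<in>J. k (x i) (y i))"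
  shows "sum g (J \<rightarrow>\<^sub>E V) * sum p (J \<rightarrow>\<^sub>E V) \<le> M ^ card J"
  using finJ assms(6-8)
proof (induction J arbitrary: g p rule: finite_induct)
  case empty
  then show ?case by (simp add: PiE_empty_domain)
next
  case (insert a J)
  define S where "S = J \<rightarrow>\<^sub>E V"
  have split: "sum f (insert a J \<rightarrow>\<^sub>E V) = (\<Sum>s\<in>V. \<Sum>x\<in>S. f (x(a := s)))"
    for f :: "('j \<Rightarrow> 'v) \<Rightarrow> real"
    unfolding PiE_insert_eq S_def sum.cartesian_product
    using insert.hyps(2) by (subst sum.reindex[OF inj_combinator]) (auto simp: case_prod_unfold)
  have upd: "x(a := s) \<in> insert a J \<rightarrow>\<^sub>E V" if "x \<in> S" "s \<in> V" for x s
    using that unfolding S_def by (intro PiE_fun_upd)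
  define g' where "g' = (\<lambda>s. \<Sum>x\<in>S. g (x(a := s)))"
  define p' where "p' = (\<lambda>s. \<Sum>x\<in>S. p (x(a := s)))"
  have step: "g' s * p' t \<le> k s t * M ^ card J" if st: "s \<in> V" "t \<in> V" for s t
  proof -
    have "(\<Sum>x\<in>S. g (x(a := s)) / k s t) * (\<Sum>x\<in>S. p (x(a := t))) \<le> M ^ card J"
      unfolding S_def
    proof (rule insert.IH)
      fix x y assume xy: "x \<in> J \<rightarrow>\<^sub>E V" "y \<in> J \<rightarrow>\<^sub>E V"
      have "g (x(a := s)) * p (y(a := t)) \<le> (\<Prod>i\<in>insert a J. k ((x(a := s)) i) ((y(a := t)) i))"
        using xy st by (intro insert.prems upd) (auto simp: S_def)
      also have "\<dots> = k s t * (\<Prod>i\<in>J. k (x i) (y i))"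
        using insert.hyps by (auto intro!: prod.cong)
      finally show "g (x(a := s)) / k s t * p (y(a := t)) \<le> (\<Prod>i\<in>J. k (x i) (y i))"
        using k[of s t] by (simp add: field_simps)
    next
      fix x assume "x \<in> J \<rightarrow>\<^sub>E V"
      then have "x(a := s) \<in> insert a J \<rightarrow>\<^sub>E V" "x(a := t) \<in> insert a J \<rightarrow>\<^sub>E V"
        using upd st by (simp_all add: S_def)
      then show "0 \<le> g (x(a := s)) / k s t" "0 \<le> p (x(a := t))"
        using insert.prems(1,2) k[of s t] by (simp_all add: less_imp_le del: fun_upd_apply)
    qed
    then show ?thesis
      using k[of s t] by (simp add: g'_def p'_def sum_divide_distrib[symmetric] field_simps)
  qed
  have MJ: "M ^ card J > 0" using M by simp
  have "(\<Sum>s\<in>V. g' s / M ^ card J) * sum p' V \<le> M"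
  proof (rule base)
    fix s t assume "s \<in> V" "t \<in> V"
    from step[OF this] show "g' s / M ^ card J * p' t \<le> k s t"
      using MJ by (simp add: field_simps)
  next
    fix s assume s: "s \<in> V"
    show "g' s / M ^ card J \<ge> 0" "p' s \<ge> 0"
      unfolding g'_def p'_def using MJ s
      by (auto intro!: divide_nonneg_pos sum_nonneg insert.prems(1,2) upd simp del: fun_upd_apply)
  qed
  then have "sum g' V * sum p' V \<le> M * M ^ card J"
    using MJ by (simp add: sum_divide_distrib[symmetric] field_simps)
  then show ?case
    using insert.hyps by (simp add: split g'_def p'_def)
qed

section \<open>The pixel grid and the space of images\<close>

lemma pixel_values_eq: "pixel_values b = (\<lambda>i. real i / (2 ^ b - 1)) ` {..<2 ^ b}"
  by (auto simp: pixel_values_def)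

text \<open>With \<open>q = 2 ^ b\<close>, pixels are spaced \<open>1 / (q - 1)\<close> rather than
  \<open>1 / q\<close>. Index distances are at most \<open>q - 1\<close>, so rescaling costs at most
  \<open>1 / q\<close>; the grid bound loses another \<open>1 / q\<close>, whence the truncation at
  \<open>2 / q\<close>.\<close>

lemma pixel_infimum_convolution:
  fixes g p :: "real \<Rightarrow> real"
  assumes b: "b \<ge> 1"
    and g: "\<And>s. s \<in> pixel_values b \<Longrightarrow> g s \<ge> 0" and p: "\<And>s. s \<in> pixel_values b \<Longrightarrow> p s \<ge> 0"
    and le: "\<And>s t. s \<in> pixel_values b \<Longrightarrow> t \<in> pixel_values b \<Longrightarrow>
      g s * p t \<le> exp ((max 0 (\<bar>s - t\<bar> - 2 / 2 ^ b))\<^sup>2)"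
  shows "sum g (pixel_values b) * sum p (pixel_values b) \<le> (2 ^ b)\<^sup>2"
proof -
  define q :: nat where "q = 2 ^ b"
  have q2: "q \<ge> 2" using b power_increasing[of 1 b "2::nat"] by (simp add: q_def)
  have rq: "real q = 2 ^ b" by (simp add: q_def)
  define v where "v = (\<lambda>i. real i / (real q - 1))"
  have V: "pixel_values b = v ` {..<q}" by (simp add: pixel_values_eq v_def q_def)
  have inj: "inj_on v {..<q}" using q2 by (auto simp: inj_on_def v_def)
  have "(\<Sum>i<q. g (v i)) * (\<Sum>i<q. p (v i)) \<le> (real q)\<^sup>2"
  proof (rule grid_infimum_convolution)
    fix i j assume ij: "i < q" "j < q"
    define d where "d = \<bar>real i - real j\<bar>"
    have d: "d \<le> real q - 1" using ij unfolding d_def by auto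
    have "\<bar>v i - v j\<bar> = d / (real q - 1)"
      using q2 by (simp add: v_def d_def diff_divide_distrib[symmetric] abs_divide)
    moreover have "d / (real q - 1) - 2 / q \<le> (d - 1) / q"
      using d q2 by (simp add: divide_simps) (simp add: algebra_simps)
    ultimately have "max 0 (\<bar>v i - v j\<bar> - 2 / q) \<le> max 0 ((d - 1) / q)" by simp
    then have "(max 0 (\<bar>v i - v j\<bar> - 2 / q))\<^sup>2 \<le> (max 0 ((d - 1) / q))\<^sup>2"
      by (intro power_mono) auto
    moreover have "g (v i) * p (v j) \<le> exp ((max 0 (\<bar>v i - v j\<bar> - 2 / q))\<^sup>2)"
      using le[of "v i" "v j"] ij by (simp add: V rq)
    ultimately show "g (v i) * p (v j) \<le> exp ((max 0 ((\<bar>real i - real j\<bar> - 1) / q))\<^sup>2)"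
      unfolding d_def by (meson exp_le_cancel_iff order_trans)
  qed (use q2 g p V in auto)
  then show ?thesis by (simp add: V sum.reindex[OF inj] rq)
qed

lemma finite_pixel_values: "finite (pixel_values b)"
  by (simp add: pixel_values_eq)

lemma card_pixel_values: "b \<ge> 1 \<Longrightarrow> card (pixel_values b) = 2 ^ b"
proof -
  assume "b \<ge> 1"
  then have "(2::real) ^ b \<ge> 2" using power_increasing[of 1 b "2::real"] by simp
  then show ?thesis unfolding pixel_values_eq by (subst card_image) (auto simp: inj_on_def)
qed

lemma pixel_values_bounds: "s \<in> pixel_values b \<Longrightarrow> 0 \<le> s \<and> s \<le> 1"
proof -
  assume "s \<in> pixel_values b"
  then obtain x :: nat where x: "s = real x / (2 ^ b - 1)" "x < 2 ^ b" by (auto simp: pixel_values_def)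
  have "real (Suc x) \<le> real (2 ^ b)" using x(2) by (subst of_nat_le_iff) simp
  then have "real x \<le> 2 ^ b - 1" by simp
  then show ?thesis unfolding x(1) by (cases "x = 0") (auto simp: divide_simps)
qed

lemma finite_tensor_indices: "finite (tensor_indices n h)"
  by (simp add: tensor_indices_def)

lemma card_tensor_indices: "card (tensor_indices n h) = n * n * h"
  by (simp add: tensor_indices_def)

lemma finite_images: "finite (images n h b)"
  by (simp add: images_def finite_PiE finite_tensor_indices finite_pixel_values)

lemma card_images: "b \<ge> 1 \<Longrightarrow> card (images n h b) = (2 ^ b) ^ card (tensor_indices n h)"
  by (simp add: images_def card_PiE finite_tensor_indices card_pixel_values)

section \<open>From robustness to separation in the truncated cost\<close>

lemma cost_gt_of_lp_norm_gt:
  fixes c :: real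
  assumes x: "x \<in> images n h b" and y: "y \<in> images n h b" and c: "c > 0" and p: "p \<ge> 2"
    and far: "lp_norm n h p (\<lambda>i. x i - y i) > (c + 2 * (real n * sqrt (real h) / 2 ^ b)) powr (2 / real p)"
  shows "(\<Sum>i\<in>tensor_indices n h. (max 0 (\<bar>x i - y i\<bar> - 2 / 2 ^ b))\<^sup>2) > c\<^sup>2"
proof -
  define J where "J = tensor_indices n h"
  define D where "D = c + 2 * (real n * sqrt (real h) / 2 ^ b)"
  define S where "S = (\<Sum>i\<in>J. (x i - y i)\<^sup>2)"
  have D0: "D > 0" using c by (simp add: D_def add_pos_nonneg)
  have le1: "\<bar>x i - y i\<bar> \<le> 1" if "i \<in> J" for i
  proof -
    have "x i \<in> pixel_values b" "y i \<in> pixel_values b"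
      using x y that by (auto simp: images_def J_def)
    then show ?thesis using pixel_values_bounds[of "x i" b] pixel_values_bounds[of "y i" b] by auto
  qed
  have "(\<Sum>i\<in>J. \<bar>x i - y i\<bar> ^ p) \<le> S"
    unfolding S_def
  proof (intro sum_mono)
    fix i assume "i \<in> J"
    then have "\<bar>x i - y i\<bar> ^ p \<le> \<bar>x i - y i\<bar> ^ 2" using le1 p by (intro power_decreasing) auto
    then show "\<bar>x i - y i\<bar> ^ p \<le> (x i - y i)\<^sup>2" by simp
  qed
  then have "lp_norm n h p (\<lambda>i. x i - y i) \<le> root p S"
    using p by (simp add: lp_norm_def J_def real_root_le_iff)
  with far have "D powr (2 / p) < root p S" by (simp add: D_def)
  \<comment> \<open>The exponent \<open>2 / p\<close> makes the bound independent of
    \<open>p\<close>: under the root, the comparison is with \<open>D^2\<close>.\<close>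
  moreover have "D powr (2 / p) = root p (D\<^sup>2)"
    using D0 p by (simp add: root_powr_inverse powr_powr flip: powr_numeral)
  ultimately have "D\<^sup>2 < S" using p by simp
  then have "sqrt (D\<^sup>2) < sqrt S" by (rule real_sqrt_less_mono)
  then have DS: "D < L2_set (\<lambda>i. x i - y i) J" using D0 by (simp add: S_def L2_set_def)
  define m where "m = (\<lambda>i. max 0 (\<bar>x i - y i\<bar> - 2 / 2 ^ b))"
  have "L2_set (\<lambda>i. x i - y i) J = L2_set (\<lambda>i. \<bar>x i - y i\<bar>) J"
    by (simp add: L2_set_def)
  also have "\<dots> \<le> L2_set (\<lambda>i. m i + 2 / 2 ^ b) J"
    by (intro L2_set_mono) (auto simp: m_def)
  also have "\<dots> \<le> L2_set m J + L2_set (\<lambda>i. 2 / 2 ^ b) J"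
    by (rule L2_set_triangle_ineq)
  \<comment> \<open>The \<open>n * n * h\<close> entries each lose at most \<open>2 / 2 ^ b\<close>;
    this is the source of the correction term in the perturbation size.\<close>
  also have "L2_set (\<lambda>i. 2 / 2 ^ b) J = 2 * (real n * sqrt (real h) / 2 ^ b)"
    by (simp add: L2_set_constant J_def card_tensor_indices real_sqrt_mult)
  finally have "c < L2_set m J" using DS by (simp add: D_def)
  then have "c\<^sup>2 < (L2_set m J)\<^sup>2" using c by (intro power_strict_mono) auto
  then show ?thesis by (simp add: L2_set_def m_def J_def sum_nonneg)
qed

lemma images_separation:
  assumes b: "b \<ge> 1" and R: "R \<subseteq> images n h b" and B: "B \<subseteq> images n h b"
    and sep: "\<And>x y. x \<in> R \<Longrightarrow> y \<in> B \<Longrightarrow>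
        (\<Sum>i\<in>tensor_indices n h. (max 0 (\<bar>x i - y i\<bar> - 2 / 2 ^ b))\<^sup>2) \<ge> C"
  shows "(card (images n h b) + card R * (exp C - 1)) * card B \<le> (real (card (images n h b)))\<^sup>2"
proof -
  define X where "X = images n h b"
  define J where "J = tensor_indices n h"
  define g where "g = (\<lambda>x. 1 + (if x \<in> R then exp C - 1 else 0))"
  define p :: "tensor \<Rightarrow> real" where "p = (\<lambda>x. if x \<in> B then 1 else 0)"
  have X: "X = J \<rightarrow>\<^sub>E pixel_values b" by (simp add: X_def J_def images_def)
  have fin: "finite X" by (simp add: X_def finite_images)
  have int: "X \<inter> R = R" "X \<inter> B = B" using R B by (auto simp: X_def)
  have "sum g X * sum p X \<le> ((2 ^ b)\<^sup>2) ^ card J"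
    unfolding X
  proof (rule infimum_convolution_PiE[where k = "\<lambda>s t. exp ((max 0 (\<bar>s - t\<bar> - 2 / 2 ^ b))\<^sup>2)"])
    fix x y assume "x \<in> J \<rightarrow>\<^sub>E pixel_values b" "y \<in> J \<rightarrow>\<^sub>E pixel_values b"
    have fJ: "finite J" by (simp add: J_def finite_tensor_indices)
    define W where "W = (\<Sum>i\<in>J. (max 0 (\<bar>x i - y i\<bar> - 2 / 2 ^ b))\<^sup>2)"
    have W0: "W \<ge> 0" by (simp add: W_def sum_nonneg)
    \<comment> \<open>On \<open>R \<times> B\<close> the product is \<open>exp C\<close>; elsewhere
      it is at most 1, and \<open>W\<close> is nonnegative.\<close>
    have "g x * p y \<le> exp W"
      using sep[of x y] W0 by (auto simp: g_def p_def W_def J_def)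
    also have "\<dots> = (\<Prod>i\<in>J. exp ((max 0 (\<bar>x i - y i\<bar> - 2 / 2 ^ b))\<^sup>2))"
      using fJ by (simp add: W_def exp_sum)
    finally show "g x * p y \<le> (\<Prod>i\<in>J. exp ((max 0 (\<bar>x i - y i\<bar> - 2 / 2 ^ b))\<^sup>2))" .
  qed (use b pixel_infimum_convolution in
      \<open>auto simp: g_def p_def finite_pixel_values J_def finite_tensor_indices\<close>)
  moreover have "sum g X = card X + card R * (exp C - 1)"
    using fin int by (simp add: g_def sum.distrib sum.If_cases)
  moreover have "sum p X = card B"
    using fin int by (simp add: p_def sum.If_cases)
  moreover have "((2 ^ b)\<^sup>2) ^ card J = (real (card X))\<^sup>2"
    using card_images[OF b, of n h] by (simp add: X_def J_def power_mult[symmetric] mult.commute mult.left_commute)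
  ultimately show ?thesis by (simp add: X_def)
qed

section \<open>The contradiction\<close>

theorem theorem3:
  fixes n h b :: nat and Y :: "'y set" and f :: "tensor \<Rightarrow> 'y"
  assumes "n \<ge> 1" and "h \<ge> 1" and "b \<ge> 1"
    and "finite Y"
    and "f \<in> images n h b \<rightarrow> Y"
  shows "\<forall>c::real. \<forall>p::nat. c > 0 \<longrightarrow> p \<ge> 2 \<longrightarrow>
           (\<forall>K \<in> induced_classes n h b Y f. interesting n h b K \<longrightarrow>
              \<not> robust_class n h b f (2 * exp (- (c\<^sup>2) / 2)) p
                  ((c + 2 * (real n * sqrt (real h) / 2 ^ b)) powr (2 / real p)) K)"
proof (intro allI impI ballI notI)
  fix c :: real and p :: nat and K
  assume c: "c > 0" and p: "p \<ge> 2" and K: "K \<in> induced_classes n h b Y f"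
    and int: "interesting n h b K"
  define d where "d = (c + 2 * (real n * sqrt (real h) / 2 ^ b)) powr (2 / real p)"
  assume "robust_class n h b f (2 * exp (- (c\<^sup>2) / 2)) p
                  ((c + 2 * (real n * sqrt (real h) / 2 ^ b)) powr (2 / real p)) K"
  then have rob: "real (card {I \<in> K. robust_image n h b f p d I}) \<ge> 2 * exp (- (c\<^sup>2) / 2) * card K"
    by (simp add: robust_class_def d_def)
  define X where "X = images n h b"
  define R where "R = {I \<in> K. robust_image n h b f p d I}"
  from K obtain l where Kl: "K = {I \<in> X. f I = l}" by (auto simp: induced_classes_def X_def)
  have finX: "finite X" by (simp add: X_def finite_images)
  have KX: "K \<subseteq> X" and RK: "R \<subseteq> K" by (auto simp: Kl R_def)
  have finK: "finite K" using KX finX by (rule finite_subset)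
  have cost: "c\<^sup>2 \<le> (\<Sum>i\<in>tensor_indices n h. (max 0 (\<bar>x i - y i\<bar> - 2 / 2 ^ b))\<^sup>2)"
    if "x \<in> R" "y \<in> X - K" for x y
  proof -
    have "f x \<noteq> f y" using that by (auto simp: R_def Kl)
    then have "lp_norm n h p (\<lambda>i. x i - y i) > d"
      using that by (force simp: R_def robust_image_def X_def)
    then show ?thesis
      using that RK KX c p unfolding d_def
      by (intro less_imp_le[OF cost_gt_of_lp_norm_gt]) (auto simp: X_def)
  qed
  \<comment> \<open>In terms of \<open>u\<close>, robustness reads \<open>2 * s \<le> r * u\<close>,
    while the separation bound involves \<open>u^2\<close>.\<close>
  define T s r u where "T = real (card X)" and "s = real (card K)" and "r = real (card R)"
    and "u = exp (c\<^sup>2 / 2)"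
  have u0: "u > 0" by (simp add: u_def)
  have "(T + r * (exp (c\<^sup>2) - 1)) * card (X - K) \<le> T\<^sup>2"
    using images_separation[OF \<open>b \<ge> 1\<close>, of R n h "X - K" "c\<^sup>2"] cost RK KX
    by (auto simp: X_def T_def r_def)
  moreover have "real (card (X - K)) = T - s"
    using finK KX finX by (simp add: card_Diff_subset T_def s_def of_nat_diff card_mono)
  moreover have "exp (c\<^sup>2) = u\<^sup>2" by (simp add: u_def flip: exp_double)
  ultimately have conc: "(T + r * (u\<^sup>2 - 1)) * (T - s) \<le> T\<^sup>2" by simp
  have s0: "s > 0" and sT: "s \<le> T / 2"
    using int finK by (auto simp: interesting_def s_def T_def X_def card_gt_0_iff)
  have rs: "r \<le> s" unfolding r_def s_def using RK finK by (simp add: card_mono)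
  have "2 * exp (- (c\<^sup>2) / 2) * s \<le> r" using rob by (simp add: r_def R_def s_def)
  moreover have "exp (- (c\<^sup>2) / 2) = 1 / u" by (simp add: u_def exp_minus inverse_eq_divide)
  ultimately have "2 * (1 / u) * s \<le> r" by metis
  then have ru: "2 * s \<le> r * u" using u0 by (simp add: field_simps)
  also have "\<dots> \<le> s * u" using rs u0 by simp
  \<comment> \<open>As \<open>r \<le> s\<close>, the assumed robustness itself excludes small
    \<open>c\<close>.\<close>
  finally have u2: "u \<ge> 2" using s0 by simp
  have r0: "r * (u\<^sup>2 - 1) \<ge> 0" using u2 by (simp add: r_def)
  have "r * (u\<^sup>2 - 1) * (T / 2) \<le> r * (u\<^sup>2 - 1) * (T - s)"
    using sT r0 by (intro mult_left_mono) auto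
  also have "\<dots> \<le> s * T" using conc by (simp add: algebra_simps power2_eq_square)
  finally have "(r * (u\<^sup>2 - 1)) * T \<le> (2 * s) * T" by simp
  then have "r * (u\<^sup>2 - 1) \<le> 2 * s" using s0 sT by simp
  also note ru
  finally have "r * (u\<^sup>2 - 1) \<le> r * u" .
  moreover have "r > 0" using ru s0 u0 by (smt (verit) mult_nonpos_nonneg)
  ultimately have "u\<^sup>2 - 1 \<le> u" by simp
  moreover have "u\<^sup>2 \<ge> 2 * u" using u2 by (simp add: power2_eq_square)
  ultimately show False using u2 by simp
qed

end
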